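(* Let $\beta=\lim_{N\to\infty}\sigma(N)^{1/N}$. Then \[1.4142\ldots=\sqrt{2}\le\beta\le \mathrm{e}^{\gamma}=1.5417\ldots.\]
   Context: A polynomial with real coefficients is called Hurwitz stable if all its (complex) zeros lie in the open left half-plane $\{z\in\mathbb{C}:\operatorname{Re} z<0\}$. For each integer $N\ge 1$, $\sigma(N)$ denotes the minimum of the sum of the coefficients over all Hurwitz stable polynomials of degree $N$ whose coefficients are all positive integers. The limit $\beta=\lim_{N\to\infty}\sigma(N)^{1/N}$ exists and equals $\inf_{N\ge1}\sigma(N)^{1/N}$. The sequence $v_0,v_1,v_2,\dots$ is defined by $v_0=1$ and $v_{n+1}=v_n+1/v_n$, and $\gamma=\sum_{j=0}^{\infty}\frac{\log v_j}{2^{j+1}}$ (natural logarithm). *)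

theory Defs
  imports Complex_Main "HOL-Computational_Algebra.Polynomial"
begin

definition hurwitz_stable :: "real poly \<Rightarrow> bool" where
  "hurwitz_stable p \<longleftrightarrow> (\<forall>z::complex. poly (map_poly complex_of_real p) z = 0 \<longrightarrow> Re z < 0)"

definition stable_pos_int_polys :: "nat \<Rightarrow> int poly set" where
  "stable_pos_int_polys N =
     {p. degree p = N \<and> (\<forall>i\<le>N. coeff p i > 0) \<and> hurwitz_stable (map_poly real_of_int p)}"

(* The set of coefficient sums is nonempty because (1 + x)^N belongs to
   stable_pos_int_polys N, so the minimum is attained. *)
definition sigma :: "nat \<Rightarrow> nat" where
  "sigma N = (LEAST s. \<exists>p \<in> stable_pos_int_polys N. int s = (\<Sum>i\<le>N. coeff p i))"

(* The term at N = 0 is a junk value (root 0 is constantly 0), which does not affect the limit. *)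
definition beta :: real where
  "beta = lim (\<lambda>N. root N (real (sigma N)))"

primrec v_seq :: "nat \<Rightarrow> real" where
  "v_seq 0 = 1"
| "v_seq (Suc n) = v_seq n + 1 / v_seq n"

definition gamma :: real where
  "gamma = (\<Sum>j. ln (v_seq j) / 2 ^ (j + 1))"

end

theory Submission
  imports Defs "HOL-Computational_Algebra.Fundamental_Theorem_Algebra"
begin

text \<open>
  If z is a zero of a Hurwitz stable polynomial then |1 - z|^2 > 1 + |z|^2 \<ge> 2 |z|. Multiplying over
  all zeros bounds the square of the value at 1 from below by 2^N times the product of the leading
  and the constant coefficient, which is at least 2^N for positive integer coefficients.

  For the upper bound, x + 1/x lies in the left half-plane exactly when x does, so
  p(x) \<mapsto> x^N p(x + 1/x) preserves stability while doubling the degree N. Starting from 1 + x, the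
  value at 1 of the k-th iterate is an evaluation of 1 + x at v_k multiplied by powers of the v_j
  with j < k, and its 2^k-th root tends to exp(gamma). Submultiplicativity of sigma
  makes beta a genuine limit, so it may be computed along the degrees 2^k.
\<close>

section \<open>Evaluation of integer polynomials in larger rings\<close>

abbreviation eval_of_int :: "int poly \<Rightarrow> 'a \<Rightarrow> 'a::{comm_ring_1,ring_char_0}" where
  "eval_of_int p z \<equiv> poly (map_poly of_int p) z"

lemma eval_of_int_add: "eval_of_int (p + q) z = eval_of_int p z + eval_of_int q z"
proof -
  have "map_poly of_int (p + q) = map_poly of_int p + (map_poly of_int q :: 'a poly)"
    by (intro poly_eqI) (simp add: coeff_map_poly)
  then show ?thesis by simp
qed

lemma eval_of_int_mult: "eval_of_int (p * q) z = eval_of_int p z * eval_of_int q z"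
proof -
  have "map_poly of_int (p * q) = map_poly of_int p * (map_poly of_int q :: 'a poly)"
    by (intro poly_eqI) (simp add: coeff_map_poly coeff_mult)
  then show ?thesis by simp
qed

lemma eval_of_int_power: "eval_of_int (p ^ n) z = eval_of_int p z ^ n"
  by (induction n) (simp_all add: eval_of_int_mult)

lemma eval_of_int_sum: "eval_of_int (\<Sum>i\<in>A. f i) z = (\<Sum>i\<in>A. eval_of_int (f i) z)"
  by (induction A rule: infinite_finite_induct) (simp_all add: eval_of_int_add)

lemma eval_of_int_smult: "eval_of_int (smult c p) z = of_int c * eval_of_int p z"
  by (simp add: map_poly_smult)

lemma eval_of_int_altdef: "eval_of_int p z = (\<Sum>i\<le>degree p. of_int (coeff p i) * z ^ i)"
  by (simp add: poly_altdef coeff_map_poly degree_map_poly)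

lemma eval_of_int_one: "eval_of_int p 1 = of_int (poly p 1)"
  by (simp add: eval_of_int_altdef poly_altdef[of p])

section \<open>The admissible polynomials, their products, and the minimum
  \<open>sigma\<close>\<close>

lemma sum_coeff_eq: "degree p = N \<Longrightarrow> (\<Sum>i\<le>N. coeff p i) = poly p (1 :: int)"
  by (auto simp: poly_altdef)

text \<open>Collapses the embedding of coefficients from integers via reals to complex numbers into
  one step, so that stability is expressed by \<open>eval_of_int\<close>.\<close>

lemma stable_pos_int_polys_iff:
  "p \<in> stable_pos_int_polys N \<longleftrightarrow> degree p = N \<and> (\<forall>i\<le>N. coeff p i > 0) \<and>
     (\<forall>z :: complex. eval_of_int p z = 0 \<longrightarrow> Re z < 0)"
proof -
  have "map_poly complex_of_real (map_poly real_of_int p) = map_poly of_int p"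
    by (intro poly_eqI) (simp add: coeff_map_poly)
  then show ?thesis by (simp add: stable_pos_int_polys_def hurwitz_stable_def)
qed

lemma stable_pos_int_polys_mult:
  assumes "p \<in> stable_pos_int_polys M" "q \<in> stable_pos_int_polys N"
  shows "p * q \<in> stable_pos_int_polys (M + N)"
proof -
  have p: "degree p = M" "\<And>i. i \<le> M \<Longrightarrow> coeff p i > 0"
    and q: "degree q = N" "\<And>i. i \<le> N \<Longrightarrow> coeff q i > 0"
    using assms by (auto simp: stable_pos_int_polys_iff)
  have nonneg: "coeff p i \<ge> 0" "coeff q i \<ge> 0" for i
    using p q by (cases "i \<le> M"; cases "i \<le> N"; force simp: coeff_eq_0 not_le)+
  have "coeff (p * q) k > 0" if "k \<le> M + N" for k
  proof -
    \<comment> \<open>All terms of the Cauchy product are nonnegative; at index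
      \<open>min k M\<close> both factors lie within their degree ranges, so that term is
      positive.\<close>
    have "min k M \<le> k" "min k M \<le> M" "k - min k M \<le> N" using that by auto
    then show ?thesis unfolding coeff_mult
      by (intro sum_pos2[where i = "min k M"]) (auto intro!: mult_pos_pos p q mult_nonneg_nonneg nonneg)
  qed
  moreover have "degree (p * q) = M + N"
    using p q by (subst degree_mult_eq) (use p(2)[of 0] q(2)[of 0] in auto)
  ultimately show ?thesis
    using assms by (auto simp: stable_pos_int_polys_iff eval_of_int_mult)
qed

lemma linear_in_stable_pos_int_polys: "[:1, 1:] \<in> stable_pos_int_polys 1"
proof -
  have "Re z < 0" if "1 + z = 0" for z :: complex
  proof -
    have "z = -1" using that by (simp add: add_eq_0_iff)
    then show ?thesis by simp
  qed
  then show ?thesis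
    by (auto simp: stable_pos_int_polys_iff map_poly_pCons coeff_pCons split: nat.split)
qed

lemma stable_pos_int_polys_nonempty: "stable_pos_int_polys N \<noteq> {}"
proof (induction N)
  case 0
  have "1 \<in> stable_pos_int_polys 0" by (simp add: stable_pos_int_polys_iff)
  then show ?case by blast
next
  case (Suc N)
  then show ?case
    using stable_pos_int_polys_mult[OF _ linear_in_stable_pos_int_polys, of _ N] by auto
qed

lemma poly_one_nonneg:
  assumes "p \<in> stable_pos_int_polys N"
  shows "poly p 1 \<ge> 0"
  using assms unfolding poly_altdef[of p]
  by (intro sum_nonneg) (auto simp: stable_pos_int_polys_iff intro: less_imp_le)

lemma sigma_le:
  assumes "p \<in> stable_pos_int_polys N"
  shows "int (sigma N) \<le> poly p 1"
proof -
  have "sigma N \<le> nat (poly p 1)"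
    unfolding sigma_def using assms poly_one_nonneg[OF assms]
    by (intro Least_le bexI[of _ p]) (auto simp: sum_coeff_eq stable_pos_int_polys_iff)
  then show ?thesis using poly_one_nonneg[OF assms] by simp
qed

lemma sigma_attained:
  obtains p where "p \<in> stable_pos_int_polys N" "int (sigma N) = poly p 1"
proof -
  obtain p where p: "p \<in> stable_pos_int_polys N"
    using stable_pos_int_polys_nonempty by blast
  have "\<exists>p \<in> stable_pos_int_polys N. int (sigma N) = (\<Sum>i\<le>N. coeff p i)"
    unfolding sigma_def
    by (rule LeastI[of _ "nat (poly p 1)"], rule bexI[OF _ p])
       (use p poly_one_nonneg[OF p] in \<open>auto simp: sum_coeff_eq stable_pos_int_polys_iff\<close>)
  then show thesis using that by (auto simp: sum_coeff_eq stable_pos_int_polys_iff)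
qed

lemma sigma_add_le: "sigma (M + N) \<le> sigma M * sigma N"
proof -
  obtain p where p: "p \<in> stable_pos_int_polys M" "int (sigma M) = poly p 1"
    by (rule sigma_attained)
  obtain q where q: "q \<in> stable_pos_int_polys N" "int (sigma N) = poly q 1"
    by (rule sigma_attained)
  have "int (sigma (M + N)) \<le> int (sigma M * sigma N)"
    using sigma_le[OF stable_pos_int_polys_mult[OF p(1) q(1)]] p q by simp
  then show ?thesis by linarith
qed

subsection \<open>Lower bound for the coefficient sum\<close>

lemma norm_poly_one_ge:
  fixes P :: "complex poly"
  assumes "\<And>z. poly P z = 0 \<Longrightarrow> Re z \<le> 0"
  shows "2 ^ degree P * (cmod (lead_coeff P) * cmod (poly P 0)) \<le> (cmod (poly P 1))\<^sup>2"
proof -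
  obtain r where r: "smult (lead_coeff P) (\<Prod>i<degree P. [:-r i, 1:]) = P"
    by (rule complex_poly_decompose')
  have ev: "poly P z = lead_coeff P * (\<Prod>i<degree P. z - r i)" for z
    by (subst r[symmetric]) (simp add: poly_prod)
  have "2 * cmod (r i) \<le> (cmod (1 - r i))\<^sup>2" if "i < degree P" for i
  proof -
    have "poly P (r i) = 0"
      unfolding ev using that by (auto intro!: prod_zero)
    then have "Re (r i) \<le> 0" by (rule assms)
    moreover have "(cmod (1 - r i))\<^sup>2 = 1 - 2 * Re (r i) + (cmod (r i))\<^sup>2"
      unfolding cmod_power2 by (simp add: power2_eq_square algebra_simps)
    moreover have "2 * cmod (r i) \<le> 1 + (cmod (r i))\<^sup>2"
      using sum_squares_bound[of 1 "cmod (r i)"] by simp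
    ultimately show ?thesis by linarith
  qed
  then have "(\<Prod>i<degree P. 2 * cmod (r i)) \<le> (\<Prod>i<degree P. (cmod (1 - r i))\<^sup>2)"
    by (intro prod_mono) auto
  then have "2 ^ degree P * (\<Prod>i<degree P. cmod (r i)) \<le> (\<Prod>i<degree P. cmod (1 - r i))\<^sup>2"
    by (simp add: prod.distrib prod_power_distrib)
  \<comment> \<open>On the left, one copy of the leading coefficient combines with the moduli of the
    zeros into \<open>cmod (poly P 0)\<close> and the other copy remains; on the right, both are
    absorbed by the square of \<open>cmod (poly P 1)\<close>.\<close>
  then have "(cmod (lead_coeff P))\<^sup>2 * (2 ^ degree P * (\<Prod>i<degree P. cmod (r i)))
      \<le> (cmod (lead_coeff P))\<^sup>2 * (\<Prod>i<degree P. cmod (1 - r i))\<^sup>2"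
    by (intro mult_left_mono) simp_all
  moreover have "cmod (poly P 0) = cmod (lead_coeff P) * (\<Prod>i<degree P. cmod (r i))"
    "cmod (poly P 1) = cmod (lead_coeff P) * (\<Prod>i<degree P. cmod (1 - r i))"
    unfolding ev by (simp_all add: norm_mult flip: prod_norm)
  ultimately show ?thesis
    by (simp add: power2_eq_square mult_ac)
qed

lemma two_power_le_sigma: "2 ^ N \<le> (real (sigma N))\<^sup>2"
proof -
  obtain p where p: "p \<in> stable_pos_int_polys N" "int (sigma N) = poly p 1"
    by (rule sigma_attained)
  define P where "P = (map_poly of_int p :: complex poly)"
  have deg: "degree p = N" and pos: "coeff p N \<ge> 1" "coeff p 0 \<ge> 1"
    using p(1) by (auto simp: stable_pos_int_polys_iff int_one_le_iff_zero_less)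
  have degP: "degree P = N" by (simp add: P_def degree_map_poly deg)
  have "(cmod (poly P 1))\<^sup>2 = (real (sigma N))\<^sup>2"
  proof -
    have "poly P 1 = of_int (poly p 1)"
      unfolding P_def by (rule eval_of_int_one)
    then show ?thesis by (simp flip: p(2))
  qed
  moreover have "2 ^ N * (cmod (lead_coeff P) * cmod (poly P 0)) \<le> (cmod (poly P 1))\<^sup>2"
    using norm_poly_one_ge[of P] p(1) unfolding degP
    by (auto simp: P_def stable_pos_int_polys_iff intro: less_imp_le)
  moreover have "cmod (lead_coeff P) * cmod (poly P 0) \<ge> 1 * 1"
    unfolding degP using pos
    by (intro mult_mono) (auto simp: P_def coeff_map_poly poly_0_coeff_0)
  then have "2 ^ N * 1 \<le> 2 ^ N * (cmod (lead_coeff P) * cmod (poly P 0))"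
    by (intro mult_left_mono) auto
  ultimately show ?thesis by linarith
qed

text \<open>Makes ln(\<open>sigma\<close>) well behaved and nonnegative, as the subadditivity
  argument requires.\<close>

lemma sigma_ge_1: "sigma N \<ge> 1"
proof -
  have "0 < (2 :: real) ^ N" by simp
  also have "\<dots> \<le> (real (sigma N))\<^sup>2" by (rule two_power_le_sigma)
  finally show ?thesis by (simp add: Suc_le_eq)
qed

subsection \<open>Existence of the limit\<close>

text \<open>Fekete's lemma: the limit is the infimum over n >= 1, which is finite by nonnegativity.
  Division with remainder by a nearly optimal m gives the upper estimate.\<close>

lemma subadditive_convergent:
  fixes a :: "nat \<Rightarrow> real"
  assumes nonneg: "\<And>n. a n \<ge> 0" and sub: "\<And>m n. a (m + n) \<le> a m + a n"
  shows "convergent (\<lambda>n. a n / real n)"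
proof -
  define L where "L = (INF n\<in>{1..}. a n / real n)"
  have bdd: "bdd_below ((\<lambda>n. a n / real n) ` {1..})"
    by (intro bdd_belowI[of _ 0]) (auto simp: nonneg)
  \<comment> \<open>The induction starts at q = 1, since q = 0 would claim a(0) <= 0, which can
    fail.\<close>
  have mult: "a (q * m) \<le> real q * a m" if "q \<ge> 1" for m q
    using that
  proof (induction q rule: nat_induct_at_least)
    case (Suc q)
    then show ?case using sub[of m "q * m"] by (simp add: algebra_simps)
  qed simp
  have "(\<lambda>n. a n / real n) \<longlonglongrightarrow> L"
  proof (rule order_tendstoI)
    fix y assume "y < L"
    have "L \<le> a n / real n" if "n \<ge> 1" for n
      unfolding L_def using that bdd by (intro cINF_lower) auto
    then show "eventually (\<lambda>n. y < a n / real n) sequentially"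
      using \<open>y < L\<close> by (intro eventually_sequentiallyI[of 1]) (meson less_le_trans)
  next
    fix y assume "L < y"
    then obtain m where m: "m \<ge> 1" "a m / real m < y"
      unfolding L_def using bdd by (subst (asm) cINF_less_iff) auto
    \<comment> \<open>\<open>C\<close> dominates a(r) for every remainder r modulo m at once, so its
      contribution C/n vanishes.\<close>
    define C where "C = (\<Sum>r\<le>m. a r)"
    have bound: "a n / real n \<le> a m / real m + C / real n" if n: "n \<ge> m" for n
    proof -
      have "n div m \<ge> 1" using n m by (simp add: Suc_le_eq div_greater_zero_iff)
      have "a n \<le> a (n div m * m) + a (n mod m)"
        using sub[of "n div m * m" "n mod m"] by simp
      also have "a (n mod m) \<le> C"
        unfolding C_def using m nonneg
        by (intro member_le_sum) (auto intro: less_imp_le mod_less_divisor)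
      also have "a (n div m * m) \<le> real (n div m) * a m"
        using mult[OF \<open>n div m \<ge> 1\<close>] .
      also have "real (n div m) * a m \<le> real n / real m * a m"
        by (rule mult_right_mono[OF of_nat_div_le_of_nat nonneg])
      finally have "a n \<le> real n / real m * a m + C" by simp
      then show ?thesis using m n by (simp add: field_simps)
    qed
    have "(\<lambda>n. a m / real m + C / real n) \<longlonglongrightarrow> a m / real m + 0"
      by (intro tendsto_intros lim_const_over_n)
    then have "eventually (\<lambda>n. a m / real m + C / real n < y) sequentially"
      using m by (auto dest: order_tendstoD(2))
    moreover have "eventually (\<lambda>n. n \<ge> m) sequentially" by (rule eventually_ge_at_top)
    ultimately show "eventually (\<lambda>n. a n / real n < y) sequentially"
      by eventually_elim (use bound in fastforce)
  qed
  then show ?thesis by (rule convergentI)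
qed

lemma root_eq_exp_ln: "x > 0 \<Longrightarrow> n > 0 \<Longrightarrow> root n x = exp (ln x / real n)"
  by (metis exp_ln ln_root real_root_gt_zero)

text \<open>\<open>beta\<close> is given by \<open>lim\<close>, which carries information only once
  convergence is known; that follows from Fekete's lemma for ln(\<open>sigma\<close>). The roots
  agree with the exponentials only from N = 1 on, hence the eventual equality.\<close>

lemma beta_tendsto: "(\<lambda>N. root N (real (sigma N))) \<longlonglongrightarrow> beta"
proof -
  have pos: "real (sigma N) > 0" for N
    using sigma_ge_1[of N] by simp
  have "ln (real (sigma (M + N))) \<le> ln (real (sigma M)) + ln (real (sigma N))" for M N
  proof -
    have "real (sigma (M + N)) \<le> real (sigma M) * real (sigma N)"
      using sigma_add_le[of M N] by (simp flip: of_nat_mult)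
    then have "ln (real (sigma (M + N))) \<le> ln (real (sigma M) * real (sigma N))"
      using pos by (intro ln_mono) auto
    then show ?thesis using pos[of M] pos[of N] by (simp add: ln_mult)
  qed
  then have "convergent (\<lambda>N. ln (real (sigma N)) / real N)"
    using sigma_ge_1 by (intro subadditive_convergent) auto
  then obtain l where "(\<lambda>N. ln (real (sigma N)) / real N) \<longlonglongrightarrow> l"
    by (auto simp: convergent_def)
  then have "(\<lambda>N. exp (ln (real (sigma N)) / real N)) \<longlonglongrightarrow> exp l"
    by (rule tendsto_exp)
  then have "(\<lambda>N. root N (real (sigma N))) \<longlonglongrightarrow> exp l"
    by (rule Lim_transform_eventually)
       (use pos in \<open>auto intro!: eventually_sequentiallyI[of 1] simp: root_eq_exp_ln\<close>)
  then show ?thesis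
    unfolding beta_def by (simp add: convergentI convergent_LIMSEQ_iff[symmetric])
qed

lemma sqrt2_le_beta: "sqrt 2 \<le> beta"
proof (rule LIMSEQ_le_const[OF beta_tendsto], intro exI allI impI)
  fix N :: nat assume N: "N \<ge> 1"
  have "sqrt 2 ^ N = sqrt (2 ^ N)" by (simp add: real_sqrt_power)
  also have "\<dots> \<le> sqrt ((real (sigma N))\<^sup>2)"
    using two_power_le_sigma by (rule real_sqrt_le_mono)
  finally have "sqrt 2 ^ N \<le> real (sigma N)" by simp
  then have "root N (sqrt 2 ^ N) \<le> root N (real (sigma N))"
    using N by (intro real_root_le_mono) auto
  then show "sqrt 2 \<le> root N (real (sigma N))"
    using N by (simp add: real_root_power_cancel)
qed

subsection \<open>The substitution x + 1/x\<close>

text \<open>This is x^d p(x + 1/x) with d the degree of p: clearing denominators turns (x + 1/x)^i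
  into x^(d-i) (1 + x^2)^i.\<close>

definition joukowski :: "int poly \<Rightarrow> int poly" where
  "joukowski p = (\<Sum>i\<le>degree p. smult (coeff p i) (monom 1 (degree p - i) * [:1, 0, 1:] ^ i))"

text \<open>Kept general in the field: the complex case transfers stability, the real case computes
  values at \<open>v_seq\<close>.\<close>

lemma eval_joukowski:
  fixes z :: "'a::field_char_0"
  assumes "z \<noteq> 0"
  shows "eval_of_int (joukowski p) z = z ^ degree p * eval_of_int p (z + 1 / z)"
proof -
  have "eval_of_int (joukowski p) z =
      (\<Sum>i\<le>degree p. of_int (coeff p i) * (z ^ (degree p - i) * (1 + z * z) ^ i))"
    by (simp add: joukowski_def eval_of_int_sum eval_of_int_smult eval_of_int_mult
          eval_of_int_power map_poly_monom poly_monom map_poly_pCons)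
  also have "\<dots> = (\<Sum>i\<le>degree p. z ^ degree p * (of_int (coeff p i) * (z + 1 / z) ^ i))"
  proof (rule sum.cong)
    fix i assume "i \<in> {..degree p}"
    then have "z ^ degree p = z ^ (degree p - i) * z ^ i"
      by (simp flip: power_add)
    moreover have "(1 + z * z) ^ i = z ^ i * (z + 1 / z) ^ i"
      using assms by (simp add: field_simps flip: power_mult_distrib)
    ultimately show "of_int (coeff p i) * (z ^ (degree p - i) * (1 + z * z) ^ i) =
        z ^ degree p * (of_int (coeff p i) * (z + 1 / z) ^ i)"
      by (simp add: mult_ac)
  qed simp
  finally show ?thesis
    by (simp add: eval_of_int_altdef sum_distrib_left)
qed

lemma coeff_one_plus_square_power:
  "coeff ([:1, 0, 1:] ^ n :: int poly) k = (if even k then int (n choose (k div 2)) else 0)"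
proof (induction n arbitrary: k)
  case (Suc n)
  \<comment> \<open>Multiplying by 1 + x^2 adds a copy shifted by two; on even indices this is
    Pascal's rule.\<close>
  have *: "coeff ([:1, 0, 1:] ^ Suc n :: int poly) k =
      coeff ([:1, 0, 1:] ^ n) k + (if k < 2 then 0 else coeff ([:1, 0, 1:] ^ n) (k - 2))"
    by (cases k; cases "k - 1") (auto simp: coeff_pCons)
  show ?case
  proof (cases "k < 2")
    case True
    then show ?thesis unfolding * Suc.IH by (auto simp: less_2_cases_iff)
  next
    case False
    then obtain j where "k = Suc (Suc j)" by (metis add_2_eq_Suc le_Suc_ex not_less)
    then show ?thesis unfolding * Suc.IH by simp
  qed
qed (auto simp: coeff_1 binomial_eq_0_iff elim!: evenE)

lemma joukowski_stable:
  assumes p: "p \<in> stable_pos_int_polys N" and N: "N \<ge> 1"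
  shows "joukowski p \<in> stable_pos_int_polys (2 * N)"
proof -
  have deg: "degree p = N" and pos: "\<And>i. i \<le> N \<Longrightarrow> coeff p i > 0"
    and stable: "\<And>z :: complex. eval_of_int p z = 0 \<Longrightarrow> Re z < 0"
    using p by (auto simp: stable_pos_int_polys_iff)
  have coeff: "coeff (joukowski p) k = (\<Sum>i\<le>N. coeff p i *
      (if k < N - i then 0 else coeff ([:1, 0, 1:] ^ i) (k - (N - i))))" for k
    by (auto simp: joukowski_def deg coeff_sum coeff_monom_mult intro!: sum.cong)
  have pos': "coeff (joukowski p) k > 0" if k: "k \<le> 2 * N" for k
  proof -
    \<comment> \<open>Summand i reaches x^k only if k - (N - i) is even and between 0 and 2i. The
      choice i = N covers even k, and i = N - 1 covers odd k.\<close>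
    define i where "i = (if even k then N else N - 1)"
    have "i \<le> N" "\<not> k < N - i" "even (k - (N - i))" "(k - (N - i)) div 2 \<le> i"
      using k N by (auto simp: i_def elim!: evenE oddE)
    then have "coeff p i *
        (if k < N - i then 0 else coeff ([:1, 0, 1:] ^ i) (k - (N - i))) > 0"
      using pos[of i] by (simp add: coeff_one_plus_square_power)
    with \<open>i \<le> N\<close> show ?thesis
      unfolding coeff
      by (intro sum_pos2[where i = i])
         (auto simp: coeff_one_plus_square_power intro!: mult_nonneg_nonneg less_imp_le[OF pos])
  qed
  have "degree (joukowski p) = 2 * N"
  proof (rule antisym)
    show "degree (joukowski p) \<le> 2 * N"
    proof (rule degree_le, intro allI impI)
      fix k assume "2 * N < k"
      then show "coeff (joukowski p) k = 0"
        unfolding coeff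
      proof (intro sum.neutral ballI)
        fix i assume "i \<in> {..N}"
        \<comment> \<open>Here k - (N - i) > N + i >= 2i, beyond the degree of (1 + x^2)^i.\<close>
        with \<open>2 * N < k\<close> have "2 * i < k - (N - i)" by auto
        then have "coeff ([:1, 0, 1:] ^ i :: int poly) (k - (N - i)) = 0"
          by (intro coeff_eq_0) (simp add: degree_power_eq)
        then show "coeff p i *
            (if k < N - i then 0 else coeff ([:1, 0, 1:] ^ i) (k - (N - i))) = 0" by simp
      qed
    qed
    show "2 * N \<le> degree (joukowski p)"
      using pos'[of "2 * N"] by (intro le_degree) auto
  qed
  moreover have "Re z < 0" if z: "eval_of_int (joukowski p) z = 0" for z :: complex
  proof -
    \<comment> \<open>The positive constant coefficient excludes the zero z = 0, where z + 1/z makes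
      no sense.\<close>
    have "eval_of_int (joukowski p) (0 :: complex) = of_int (coeff (joukowski p) 0)"
      by (simp add: poly_0_coeff_0 coeff_map_poly)
    with z pos'[of 0] have "z \<noteq> 0" by auto
    then have "eval_of_int p (z + 1 / z) = 0"
      using z by (simp add: eval_joukowski)
    then have "Re (z + 1 / z) < 0" by (rule stable)
    \<comment> \<open>Since Re(1/z) = Re z / |z|^2, the real parts of z + 1/z and z have the same
      sign.\<close>
    also have "Re (z + 1 / z) = Re z * (1 + 1 / (cmod z)\<^sup>2)"
      by (simp add: Re_divide cmod_power2 algebra_simps)
    finally have "Re z * (1 + 1 / (cmod z)\<^sup>2) < 0" .
    moreover have "1 + 1 / (cmod z)\<^sup>2 > 0" by (simp add: add_pos_nonneg)
    ultimately show ?thesis by (simp add: mult_less_0_iff not_less[symmetric])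
  qed
  ultimately show ?thesis
    using pos' by (simp add: stable_pos_int_polys_iff)
qed

abbreviation joukowski_iter :: "nat \<Rightarrow> int poly" where
  "joukowski_iter k \<equiv> (joukowski ^^ k) [:1, 1:]"

lemma joukowski_iter_stable: "joukowski_iter k \<in> stable_pos_int_polys (2 ^ k)"
proof (induction k)
  case 0
  then show ?case using linear_in_stable_pos_int_polys by simp
next
  case (Suc k)
  then show ?case using joukowski_stable[OF Suc.IH] by simp
qed

subsection \<open>The upper bound\<close>

lemma v_seq_ge_1: "v_seq n \<ge> 1"
  by (induction n) (auto intro: add_increasing2)

lemma v_seq_pos [simp]: "v_seq n > 0"
  using v_seq_ge_1[of n] by linarith

text \<open>A crude bound, enough to make ln(1 + v_k) / 2^k vanish in the limit.\<close>

lemma v_seq_le: "v_seq n \<le> real n + 1"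
proof (induction n)
  case (Suc n)
  moreover have "1 / v_seq n \<le> 1" using v_seq_ge_1[of n] by (simp add: divide_le_eq)
  ultimately have "v_seq n + 1 / v_seq n \<le> real n + 1 + 1" by linarith
  then show ?case by simp
qed simp

lemma v_seq_mono: "m \<le> n \<Longrightarrow> v_seq m \<le> v_seq n"
  by (rule lift_Suc_mono_le) (simp_all add: less_imp_le)

lemma joukowski_iter_at_v_seq_pos: "eval_of_int (joukowski_iter k) (v_seq j) > 0"
proof -
  have "degree (joukowski_iter k) = 2 ^ k" "\<And>i. i \<le> 2 ^ k \<Longrightarrow> coeff (joukowski_iter k) i > 0"
    using joukowski_iter_stable[of k] by (auto simp: stable_pos_int_polys_iff)
  then show ?thesis
    unfolding eval_of_int_altdef by (intro sum_pos) auto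
qed

text \<open>As v_j + 1/v_j = v_(j+1), removing one \<open>joukowski\<close> moves the evaluation
  point from v_j to v_(j+1) and releases a power of v_j; hence the induction over all j. For j = 0
  the sum is a partial sum of \<open>gamma\<close>.\<close>

lemma ln_joukowski_iter:
  "ln (eval_of_int (joukowski_iter k) (v_seq j)) / 2 ^ k =
     (\<Sum>i<k. ln (v_seq (j + i)) / 2 ^ (i + 1)) + ln (1 + v_seq (j + k)) / 2 ^ k"
proof (induction k arbitrary: j)
  case (Suc k)
  have deg: "degree (joukowski_iter k) = 2 ^ k"
    using joukowski_iter_stable[of k] by (simp add: stable_pos_int_polys_iff)
  have "eval_of_int (joukowski_iter (Suc k)) (v_seq j) =
      v_seq j ^ 2 ^ k * eval_of_int (joukowski_iter k) (v_seq (Suc j))"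
    using eval_joukowski[of "v_seq j" "joukowski_iter k"] v_seq_pos[of j] by (simp add: deg)
  then have "ln (eval_of_int (joukowski_iter (Suc k)) (v_seq j)) / 2 ^ Suc k =
      ln (v_seq j) / 2 + (ln (eval_of_int (joukowski_iter k) (v_seq (Suc j))) / 2 ^ k) / 2"
    using joukowski_iter_at_v_seq_pos[of k "Suc j"]
    by (simp add: ln_mult_pos ln_realpow add_divide_distrib del: v_seq.simps)
  also have "\<dots> = (\<Sum>i<Suc k. ln (v_seq (j + i)) / 2 ^ (i + 1)) +
      ln (1 + v_seq (j + Suc k)) / 2 ^ Suc k"
    unfolding Suc.IH sum.lessThan_Suc_shift
    by (simp add: add_divide_distrib sum_divide_distrib mult_ac del: v_seq.simps)
  finally show ?case .
qed (simp add: map_poly_pCons)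

section \<open>Convergence of the series for \<open>gamma\<close> and of its tails\<close>

lemma sums_over_two_power: "(\<lambda>j. real j / 2 ^ (j + 1)) sums 1"
proof -
  \<comment> \<open>At 1/2 the differentiated geometric series sums to 4 and the plain one to 2;
    half the difference is 1.\<close>
  have "(\<lambda>j. real (Suc j) * (1 / 2) ^ j) sums (1 / (1 - 1 / 2)\<^sup>2)"
    by (rule geometric_deriv_sums) simp
  from sums_diff[OF this geometric_sums[of "1 / 2 :: real"]]
  have "(\<lambda>j. real j * (1 / 2) ^ j) sums 2"
    by (simp add: algebra_simps power2_eq_square)
  from sums_divide[OF this, of 2] show ?thesis
    by (simp add: power_divide mult_ac)
qed

lemma sums_half_powers: "(\<lambda>j. c / 2 ^ (j + 1)) sums (c :: real)"
  using sums_mult[OF power_half_series, of c] by (simp add: power_divide)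

text \<open>Each step multiplies v_m by 1 + 1/v_m^2, so by ln(1 + t) <= t and monotonicity the
  logarithm grows by at most 1/v_n^2. This yields both summability and the upper tail
  estimate.\<close>

lemma ln_v_seq_add_le: "ln (v_seq (n + j)) \<le> ln (v_seq n) + real j / (v_seq n)\<^sup>2"
proof (induction j)
  case (Suc j)
  have "ln (v_seq (n + Suc j)) = ln (v_seq (n + j) * (1 + 1 / (v_seq (n + j))\<^sup>2))"
    using v_seq_pos[of "n + j"] by (simp add: field_simps power2_eq_square)
  also have "\<dots> = ln (v_seq (n + j)) + ln (1 + 1 / (v_seq (n + j))\<^sup>2)"
    by (intro ln_mult_pos) (auto intro: add_pos_nonneg)
  also have "ln (1 + 1 / (v_seq (n + j))\<^sup>2) \<le> 1 / (v_seq (n + j))\<^sup>2"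
    by (intro ln_add_one_self_le_self) simp
  also have "\<dots> \<le> 1 / (v_seq n)\<^sup>2"
    using v_seq_mono[of n "n + j"] v_seq_pos[of n]
    by (intro divide_left_mono power_mono mult_pos_pos zero_less_power less_imp_le[OF v_seq_pos]) auto
  finally show ?case using Suc.IH by (simp add: add_divide_distrib)
qed simp

lemma summable_ln_v_seq: "summable (\<lambda>j. ln (v_seq (n + j)) / 2 ^ (j + 1))"
proof (rule summable_comparison_test')
  show "summable (\<lambda>j. ln (v_seq n) / 2 ^ (j + 1) + (real j / 2 ^ (j + 1)) / (v_seq n)\<^sup>2)"
    using sums_half_powers sums_over_two_power
    by (intro summable_add summable_divide) (auto simp: sums_iff)
  show "norm (ln (v_seq (n + j)) / 2 ^ (j + 1)) \<le>
      ln (v_seq n) / 2 ^ (j + 1) + (real j / 2 ^ (j + 1)) / (v_seq n)\<^sup>2" for j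
    using divide_right_mono[OF ln_v_seq_add_le[of n j], of "2 ^ (j + 1)"] v_seq_ge_1[of "n + j"]
    by (simp add: add_divide_distrib mult_ac)
qed

section \<open>Comparison of \<open>beta\<close> with exp(\<open>gamma\<close>) along the degrees
  2^k\<close>

lemma beta_le_exp_gamma: "beta \<le> exp gamma"
proof (rule LIMSEQ_le)
  show "(\<lambda>k. root (2 ^ k) (real (sigma (2 ^ k)))) \<longlonglongrightarrow> beta"
    using LIMSEQ_subseq_LIMSEQ[OF beta_tendsto, of "\<lambda>k. 2 ^ k"]
    by (simp add: o_def strict_mono_def)
  \<comment> \<open>(k + 1) / 2^k is split into terms of two convergent series, which tend to
    0.\<close>
  have "(\<lambda>k. 2 * (real k / 2 ^ (k + 1)) + 2 * (1 / 2 ^ (k + 1))) \<longlonglongrightarrow> 2 * 0 + 2 * 0"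
    using sums_half_powers[of 1] sums_over_two_power
    by (intro tendsto_intros summable_LIMSEQ_zero) (auto simp: sums_iff)
  then have lim: "(\<lambda>k. (real k + 1) / 2 ^ k) \<longlonglongrightarrow> 0"
    by (simp add: add_divide_distrib)
  have le: "ln (1 + v_seq k) / 2 ^ k \<le> (real k + 1) / 2 ^ k" for k
  proof (rule divide_right_mono)
    have "ln (1 + v_seq k) \<le> v_seq k"
      by (intro ln_add_one_self_le_self less_imp_le[OF v_seq_pos])
    then show "ln (1 + v_seq k) \<le> real k + 1" using v_seq_le[of k] by linarith
  qed simp
  have ge: "0 \<le> ln (1 + v_seq k) / 2 ^ k" for k
    by (simp add: less_imp_le)
  have "(\<lambda>k. ln (1 + v_seq k) / 2 ^ k) \<longlonglongrightarrow> 0"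
    by (rule tendsto_sandwich[OF always_eventually always_eventually tendsto_const lim])
       (use le ge in blast)+
  moreover have "(\<lambda>k. \<Sum>i<k. ln (v_seq i) / 2 ^ (i + 1)) \<longlonglongrightarrow> gamma"
    using summable_LIMSEQ[OF summable_ln_v_seq[of 0]] by (simp add: gamma_def)
  ultimately have "(\<lambda>k. (\<Sum>i<k. ln (v_seq i) / 2 ^ (i + 1)) + ln (1 + v_seq k) / 2 ^ k) \<longlonglongrightarrow> gamma + 0"
    by (rule tendsto_add[rotated])
  then show "(\<lambda>k. exp ((\<Sum>i<k. ln (v_seq i) / 2 ^ (i + 1)) + ln (1 + v_seq k) / 2 ^ k)) \<longlonglongrightarrow> exp gamma"
    by (intro tendsto_exp) simp
  have "root (2 ^ k) (real (sigma (2 ^ k))) \<le>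
      exp ((\<Sum>i<k. ln (v_seq i) / 2 ^ (i + 1)) + ln (1 + v_seq k) / 2 ^ k)" for k
  proof -
    have "real (sigma (2 ^ k)) \<le> eval_of_int (joukowski_iter k) 1"
      using sigma_le[OF joukowski_iter_stable[of k]] unfolding eval_of_int_one by linarith
    then have "root (2 ^ k) (real (sigma (2 ^ k))) \<le> root (2 ^ k) (eval_of_int (joukowski_iter k) 1)"
      by (intro real_root_le_mono) auto
    \<comment> \<open>Reading the point 1 as \<open>v_seq 0\<close> makes
      \<open>ln_joukowski_iter\<close> applicable.\<close>
    also have "\<dots> = exp (ln (eval_of_int (joukowski_iter k) (v_seq 0)) / 2 ^ k)"
      using joukowski_iter_at_v_seq_pos[of k 0] by (simp add: root_eq_exp_ln)
    finally show ?thesis unfolding ln_joukowski_iter by simp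
  qed
  then show "\<exists>N. \<forall>k\<ge>N. root (2 ^ k) (real (sigma (2 ^ k))) \<le>
      exp ((\<Sum>i<k. ln (v_seq i) / 2 ^ (i + 1)) + ln (1 + v_seq k) / 2 ^ k)"
    by blast
qed

subsection \<open>Numerical bounds\<close>

text \<open>
  Since exp(gamma) is the nested radical sqrt(v_0 sqrt(v_1 sqrt(v_2 ...))), bounds for a tail
  propagate backwards by taking square roots.
\<close>

definition v_tail :: "nat \<Rightarrow> real" where
  "v_tail n = exp (\<Sum>j. ln (v_seq (n + j)) / 2 ^ (j + 1))"

lemma v_tail_0: "v_tail 0 = exp gamma"
  by (simp add: v_tail_def gamma_def)

lemma v_tail_square: "(v_tail n)\<^sup>2 = v_seq n * v_tail (Suc n)"
proof -
  define S where "S n = (\<Sum>j. ln (v_seq (n + j)) / 2 ^ (j + 1))" for n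
  have "S n = ln (v_seq n) / 2 + (\<Sum>j. (ln (v_seq (Suc n + j)) / 2 ^ (j + 1)) / 2)"
    unfolding S_def using suminf_split_head[OF summable_ln_v_seq[of n]]
    by (simp add: mult_ac del: v_seq.simps)
  also have "\<dots> = ln (v_seq n) / 2 + S (Suc n) / 2"
    unfolding S_def by (subst suminf_divide[OF summable_ln_v_seq]) simp
  finally have "2 * S n = ln (v_seq n) + S (Suc n)" by simp
  then have "exp (2 * S n) = v_seq n * exp (S (Suc n))"
    by (simp add: exp_add del: v_seq.simps)
  then show ?thesis by (simp add: v_tail_def S_def exp_double)
qed

text \<open>The weights 1/2^(j+1) sum to 1, so the logarithm of the tail is an average of the
  ln(v_(n+j)), each at least ln(v_n).\<close>

lemma v_tail_ge: "v_seq n \<le> v_tail n"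
proof -
  have "ln (v_seq n) \<le> (\<Sum>j. ln (v_seq (n + j)) / 2 ^ (j + 1))"
    using v_seq_mono[of n] v_seq_pos
    by (intro sums_le[OF _ sums_half_powers summable_sums[OF summable_ln_v_seq]])
       (auto intro!: divide_right_mono ln_mono)
  then have "exp (ln (v_seq n)) \<le> v_tail n" unfolding v_tail_def by (subst exp_le_cancel_iff)
  then show ?thesis by simp
qed

text \<open>The same average, taken of the linear upper bound in j; the mean of j under these
  weights is 1.\<close>

lemma v_tail_le: "v_tail n \<le> v_seq n * exp (1 / (v_seq n)\<^sup>2)"
proof -
  have "(\<Sum>j. ln (v_seq (n + j)) / 2 ^ (j + 1)) \<le> ln (v_seq n) + 1 / (v_seq n)\<^sup>2"
  proof (rule sums_le[OF _ summable_sums[OF summable_ln_v_seq]])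
    show "(\<lambda>j. ln (v_seq n) / 2 ^ (j + 1) + (real j / 2 ^ (j + 1)) / (v_seq n)\<^sup>2) sums
        (ln (v_seq n) + 1 / (v_seq n)\<^sup>2)"
      by (intro sums_add sums_half_powers sums_divide sums_over_two_power)
    show "ln (v_seq (n + j)) / 2 ^ (j + 1) \<le>
        ln (v_seq n) / 2 ^ (j + 1) + (real j / 2 ^ (j + 1)) / (v_seq n)\<^sup>2" for j
      using divide_right_mono[OF ln_v_seq_add_le[of n j], of "2 ^ (j + 1)"]
      by (simp add: add_divide_distrib mult_ac)
  qed
  then have "v_tail n \<le> exp (ln (v_seq n) + 1 / (v_seq n)\<^sup>2)" by (simp add: v_tail_def)
  then show ?thesis by (simp add: exp_add)
qed

lemma v_seq_Suc_mono:
  assumes "1 \<le> x" "x \<le> y"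
  shows "x + 1 / x \<le> y + 1 / (y :: real)"
proof -
  \<comment> \<open>After clearing denominators the claim is this inequality, which holds because xy
    >= 1.\<close>
  have "y - x \<le> (y - x) * (x * y)"
    using assms mult_mono[of 1 x 1 y] by (intro mult_le_cancel_left1[THEN iffD2]) auto
  then show ?thesis using assms by (simp add: field_simps)
qed

text \<open>The separate premise \<open>m = Suc n\<close> admits numeral indices, and the free
  \<open>l'\<close> allows rounding down to a short decimal.\<close>

lemma v_seq_ge_step:
  assumes "l \<le> v_seq n" "m = Suc n" "1 \<le> l" "l' \<le> l + 1 / l"
  shows "l' \<le> v_seq m"
  using v_seq_Suc_mono[of l "v_seq n"] assms by simp

lemma v_seq_le_step:
  assumes "v_seq n \<le> u" "m = Suc n" "u + 1 / u \<le> u'"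
  shows "v_seq m \<le> u'"
  using v_seq_Suc_mono[OF v_seq_ge_1, of n u] assms by simp

text \<open>\<open>c\<close> is a decimal below the square root of \<open>l * l'\<close>, so only
  squares of rationals are compared.\<close>

lemma v_tail_ge_step:
  assumes "l' \<le> v_tail m" "l \<le> v_seq n" "m = Suc n" "0 \<le> l" "0 \<le> l'" "c\<^sup>2 \<le> l * l'"
  shows "c \<le> v_tail n"
proof (rule power2_le_imp_le)
  have "l * l' \<le> v_seq n * v_tail m"
    using assms by (intro mult_mono) (auto intro: less_imp_le)
  then show "c\<^sup>2 \<le> (v_tail n)\<^sup>2" using assms v_tail_square[of n] by simp
qed (simp add: v_tail_def)

text \<open>exp(t) <= 1 + t + t^2 on [0, 1], applied at t = 1/l^2, leaves only rational
  arithmetic.\<close>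

lemma v_tail_le_of_bounds:
  assumes "l \<le> v_seq n" "v_seq n \<le> u" "1 \<le> l" "u * (1 + 1 / l\<^sup>2 + (1 / l\<^sup>2)\<^sup>2) \<le> c"
  shows "v_tail n \<le> c"
proof -
  have "1 / (v_seq n)\<^sup>2 \<le> 1 / l\<^sup>2"
    using assms by (intro divide_left_mono power_mono) auto
  then have "exp (1 / (v_seq n)\<^sup>2) \<le> exp (1 / l\<^sup>2)" by simp
  also have "\<dots> \<le> 1 + 1 / l\<^sup>2 + (1 / l\<^sup>2)\<^sup>2"
    using assms by (intro exp_bound) auto
  finally have "v_seq n * exp (1 / (v_seq n)\<^sup>2) \<le> u * (1 + 1 / l\<^sup>2 + (1 / l\<^sup>2)\<^sup>2)"
    using assms v_seq_pos[of n] by (intro mult_mono) auto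
  with v_tail_le[of n] assms(4) show ?thesis by linarith
qed

lemma v_tail_le_step:
  assumes "v_tail m \<le> u'" "v_seq n \<le> u" "m = Suc n" "0 \<le> u" "0 \<le> c" "u * u' \<le> c\<^sup>2"
  shows "v_tail n \<le> c"
proof (rule power2_le_imp_le)
  have "v_seq n * v_tail m \<le> u * u'"
    using assms by (intro mult_mono) (auto simp: v_tail_def)
  then show "(v_tail n)\<^sup>2 \<le> c\<^sup>2" using assms v_tail_square[of n] by simp
qed (use assms in simp)

text \<open>
  The lower bound is the delicate one, because exp(gamma) = 1.5417009...: it forces the tail to start
  as late as index 16 and intermediate values with seven decimals.
\<close>

lemma exp_gamma_bounds: "1.5417 \<le> exp gamma" "exp gamma < 1.5418"
proof -
  have v0: "1 \<le> v_seq 0" by simp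
  have v1: "2 \<le> v_seq 1" by (rule v_seq_ge_step[OF v0]) simp_all
  have v2: "2.5 \<le> v_seq 2" by (rule v_seq_ge_step[OF v1]) simp_all
  have v3: "2.9 \<le> v_seq 3" by (rule v_seq_ge_step[OF v2]) simp_all
  have v4: "3.2448275 \<le> v_seq 4" by (rule v_seq_ge_step[OF v3]) simp_all
  have v5: "3.5530102 \<le> v_seq 5" by (rule v_seq_ge_step[OF v4]) simp_all
  have v6: "3.8344616 \<le> v_seq 6" by (rule v_seq_ge_step[OF v5]) simp_all
  have v7: "4.0952544 \<le> v_seq 7" by (rule v_seq_ge_step[OF v6]) simp_all
  have v8: "4.3394394 \<le> v_seq 8" by (rule v_seq_ge_step[OF v7]) simp_all
  have v9: "4.5698839 \<le> v_seq 9" by (rule v_seq_ge_step[OF v8]) simp_all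
  have v10: "4.7887078 \<le> v_seq 10" by (rule v_seq_ge_step[OF v9]) simp_all
  have v11: "4.9975324 \<le> v_seq 11" by (rule v_seq_ge_step[OF v10]) simp_all
  have v12: "5.1976311 \<le> v_seq 12" by (rule v_seq_ge_step[OF v11]) simp_all
  have v13: "5.3900264 \<le> v_seq 13" by (rule v_seq_ge_step[OF v12]) simp_all
  have v14: "5.5755542 \<le> v_seq 14" by (rule v_seq_ge_step[OF v13]) simp_all
  have v15: "5.7549085 \<le> v_seq 15" by (rule v_seq_ge_step[OF v14]) simp_all
  have v16: "5.9286732 \<le> v_seq 16" by (rule v_seq_ge_step[OF v15]) simp_all
  \<comment> \<open>Each square root on the way back halves the logarithmic error of this crude
    start, so it is divided by 2^16 at index 0.\<close>
  have t16: "5.9286732 \<le> v_tail 16" using v16 v_tail_ge by (rule order_trans)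
  have t15: "5.8411447 \<le> v_tail 15" by (rule v_tail_ge_step[OF t16 v15]) (simp_all add: power2_eq_square)
  have t14: "5.7068046 \<le> v_tail 14" by (rule v_tail_ge_step[OF t15 v14]) (simp_all add: power2_eq_square)
  have t13: "5.5461542 \<le> v_tail 13" by (rule v_tail_ge_step[OF t14 v13]) (simp_all add: power2_eq_square)
  have t12: "5.3690654 \<le> v_tail 12" by (rule v_tail_ge_step[OF t13 v12]) (simp_all add: power2_eq_square)
  have t11: "5.1799689 \<le> v_tail 11" by (rule v_tail_ge_step[OF t12 v11]) (simp_all add: power2_eq_square)
  have t10: "4.9804977 \<le> v_tail 10" by (rule v_tail_ge_step[OF t11 v10]) (simp_all add: power2_eq_square)
  have t9: "4.7707752 \<le> v_tail 9" by (rule v_tail_ge_step[OF t10 v9]) (simp_all add: power2_eq_square)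
  have t8: "4.5499988 \<le> v_tail 8" by (rule v_tail_ge_step[OF t9 v8]) (simp_all add: power2_eq_square)
  have t7: "4.3166425 \<le> v_tail 7" by (rule v_tail_ge_step[OF t8 v7]) (simp_all add: power2_eq_square)
  have t6: "4.0684149 \<le> v_tail 6" by (rule v_tail_ge_step[OF t7 v6]) (simp_all add: power2_eq_square)
  have t5: "3.8019889 \<le> v_tail 5" by (rule v_tail_ge_step[OF t6 v5]) (simp_all add: power2_eq_square)
  have t4: "3.5123778 \<le> v_tail 4" by (rule v_tail_ge_step[OF t5 v4]) (simp_all add: power2_eq_square)
  have t3: "3.1915349 \<le> v_tail 3" by (rule v_tail_ge_step[OF t4 v3]) (simp_all add: power2_eq_square)
  have t2: "2.8246835 \<le> v_tail 2" by (rule v_tail_ge_step[OF t3 v2]) (simp_all add: power2_eq_square)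
  have t1: "2.3768397 \<le> v_tail 1" by (rule v_tail_ge_step[OF t2 v1]) (simp_all add: power2_eq_square)
  have t0: "1.5417 \<le> v_tail 0" by (rule v_tail_ge_step[OF t1 v0]) (simp_all add: power2_eq_square)
  show "1.5417 \<le> exp gamma" using t0 by (simp add: v_tail_0)
  have u0: "v_seq 0 \<le> 1" by simp
  have u1: "v_seq 1 \<le> 2" by (rule v_seq_le_step[OF u0]) simp_all
  have u2: "v_seq 2 \<le> 2.5" by (rule v_seq_le_step[OF u1]) simp_all
  have u3: "v_seq 3 \<le> 2.9" by (rule v_seq_le_step[OF u2]) simp_all
  have u4: "v_seq 4 \<le> 3.24483" by (rule v_seq_le_step[OF u3]) simp_all
  have u5: "v_seq 5 \<le> 3.55302" by (rule v_seq_le_step[OF u4]) simp_all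
  have u6: "v_seq 6 \<le> 3.83448" by (rule v_seq_le_step[OF u5]) simp_all
  have u7: "v_seq 7 \<le> 4.09528" by (rule v_seq_le_step[OF u6]) simp_all
  have u8: "v_seq 8 \<le> 4.33947" by (rule v_seq_le_step[OF u7]) simp_all
  \<comment> \<open>The room below 1.5418 is about 10^-4, so with the exponential tail estimate
    eight square roots suffice.\<close>
  have s8: "v_tail 8 \<le> 4.58216" by (rule v_tail_le_of_bounds[OF v8 u8]) (simp_all add: power2_eq_square)
  have s7: "v_tail 7 \<le> 4.33189" by (rule v_tail_le_step[OF s8 u7]) (simp_all add: power2_eq_square)
  have s6: "v_tail 6 \<le> 4.07561" by (rule v_tail_le_step[OF s7 u6]) (simp_all add: power2_eq_square)
  have s5: "v_tail 5 \<le> 3.80536" by (rule v_tail_le_step[OF s6 u5]) (simp_all add: power2_eq_square)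
  have s4: "v_tail 4 \<le> 3.51394" by (rule v_tail_le_step[OF s5 u4]) (simp_all add: power2_eq_square)
  have s3: "v_tail 3 \<le> 3.19225" by (rule v_tail_le_step[OF s4 u3]) (simp_all add: power2_eq_square)
  have s2: "v_tail 2 \<le> 2.82501" by (rule v_tail_le_step[OF s3 u2]) (simp_all add: power2_eq_square)
  have s1: "v_tail 1 \<le> 2.37698" by (rule v_tail_le_step[OF s2 u1]) (simp_all add: power2_eq_square)
  have s0: "v_tail 0 \<le> 1.54175" by (rule v_tail_le_step[OF s1 u0]) (simp_all add: power2_eq_square)
  show "exp gamma < 1.5418" using s0 by (simp add: v_tail_0)
qed

theorem corollary5p7:
  "1.4142 \<le> sqrt 2 \<and> sqrt 2 < 1.4143 \<and>
   sqrt 2 \<le> beta \<and> beta \<le> exp gamma \<and>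
   1.5417 \<le> exp gamma \<and> exp gamma < 1.5418"
proof (intro conjI)
  show "1.4142 \<le> sqrt 2" by (rule real_le_rsqrt) (simp add: power2_eq_square)
  show "sqrt 2 < 1.4143" by (rule real_less_lsqrt) (simp_all add: power2_eq_square)
qed (rule sqrt2_le_beta beta_le_exp_gamma exp_gamma_bounds)+

end
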